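(* The space $\mathcal{S}_c(\mathbb{S})$ of all nontrivial convergent sequences in the Sorgenfrey line $\mathbb{S}$, with the (subspace) Vietoris topology, is homogeneous.
   Context: $\mathbb{S}$ denotes the Sorgenfrey line; since the Sorgenfrey line is homeomorphic to its subspace $[0,1[$, one takes $\mathbb{S}=[0,1[$ with the topology having as base the half-open intervals $[c,d[$, $0\le c<d\le 1$. Vietoris topology: for a space $X$, $\operatorname{Exp}(X)$ is the set of all non-empty closed subsets of $X$, with the topology generated by the subbase of all sets $[V]=\{F\in\operatorname{Exp}(X):F\subset V\}$ and $\langle V\rangle=\{F\in\operatorname{Exp}(X):F\cap V\neq\emptyset\}$, $V$ a non-empty open subset of $X$. For a Hausdorff space $X$, a set $S\subset X$ is a nontrivial convergent sequence in $X$ if $S$ is countably infinite and there is $x\in S$ such that $S\setminus V$ is finite for every open neighborhood $V$ of $x$. $\mathcal{S}_c(X)\subset\operatorname{Exp}(X)$ is the subspace of all nontrivial convergent sequences in $X$. A topological space $Y$ is homogeneous if for all $x,y\in Y$ there is a homeomorphism $h:Y\to Y$ with $h(x)=y$. *)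

theory Defs
  imports "HOL-Analysis.Analysis"
begin

definition sorgenfrey :: "real topology" where
  "sorgenfrey = topology_generated_by {{c..<d} | c d. 0 \<le> c \<and> c < d \<and> d \<le> 1}"

definition Exp :: "'a topology \<Rightarrow> 'a set set" where
  "Exp X = {F. closedin X F \<and> F \<noteq> {}}"

definition vietoris :: "'a topology \<Rightarrow> 'a set topology" where
  "vietoris X = topology_generated_by
     ({{F \<in> Exp X. F \<subseteq> V} | V. openin X V \<and> V \<noteq> {}} \<union>
      {{F \<in> Exp X. F \<inter> V \<noteq> {}} | V. openin X V \<and> V \<noteq> {}})"

definition nontrivial_convergent_sequence :: "'a topology \<Rightarrow> 'a set \<Rightarrow> bool" where
  "nontrivial_convergent_sequence X S \<longleftrightarrow>
     S \<subseteq> topspace X \<and> countable S \<and> infinite S \<and>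
     (\<exists>x\<in>S. \<forall>V. openin X V \<and> x \<in> V \<longrightarrow> finite (S - V))"

(* subtopology intersects with the hyperspace Exp X; for Hausdorff X this loses nothing,
   see topspace_conv_seq_space. *)
definition conv_seq_space :: "'a topology \<Rightarrow> 'a set topology" where
  "conv_seq_space X = subtopology (vietoris X) {S. nontrivial_convergent_sequence X S}"

definition homogeneous_space :: "'a topology \<Rightarrow> bool" where
  "homogeneous_space Y \<longleftrightarrow>
     (\<forall>x\<in>topspace Y. \<forall>y\<in>topspace Y. \<exists>h. homeomorphic_map Y Y h \<and> h x = y)"

(* The half-open intervals, a priori only a subbase above, form a base. *)
lemma openin_sorgenfrey:
  "openin sorgenfrey U \<longleftrightarrow>
     (\<forall>x\<in>U. \<exists>c d. 0 \<le> c \<and> c < d \<and> d \<le> 1 \<and> x \<in> {c..<d} \<and> {c..<d} \<subseteq> U)"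
proof
  assume "openin sorgenfrey U"
  then have "generate_topology_on {{c..<d} | c d. 0 \<le> c \<and> c < d \<and> d \<le> (1::real)} U"
    by (simp add: sorgenfrey_def openin_topology_generated_by_iff)
  then show "\<forall>x\<in>U. \<exists>c d. 0 \<le> c \<and> c < d \<and> d \<le> 1 \<and> x \<in> {c..<d} \<and> {c..<d} \<subseteq> U"
  proof induction
    case Empty
    then show ?case by simp
  next
    case (Int A B)
    show ?case
    proof
      fix x assume x: "x \<in> A \<inter> B"
      obtain c d where A: "0 \<le> c" "c < d" "d \<le> 1" "x \<in> {c..<d}" "{c..<d} \<subseteq> A"
        using Int.IH(1) x by blast
      obtain c' d' where B: "0 \<le> c'" "c' < d'" "d' \<le> 1" "x \<in> {c'..<d'}" "{c'..<d'} \<subseteq> B"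
        using Int.IH(2) x by blast
      have "0 \<le> max c c' \<and> max c c' < min d d' \<and> min d d' \<le> 1 \<and>
            x \<in> {max c c'..<min d d'} \<and> {max c c'..<min d d'} \<subseteq> A \<inter> B"
        using A B by auto
      then show "\<exists>c d. 0 \<le> c \<and> c < d \<and> d \<le> 1 \<and> x \<in> {c..<d} \<and> {c..<d} \<subseteq> A \<inter> B"
        by blast
    qed
  next
    case (UN K)
    then show ?case by (meson Union_iff Union_upper subset_trans)
  next
    case (Basis s)
    then show ?case by blast
  qed
next
  assume R: "\<forall>x\<in>U. \<exists>c d. 0 \<le> c \<and> c < d \<and> d \<le> 1 \<and> x \<in> {c..<d} \<and> {c..<d} \<subseteq> U"
  show "openin sorgenfrey U"
  proof (subst openin_subopen, intro ballI)
    fix x assume "x \<in> U"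
    then obtain c d where "0 \<le> c" "c < d" "d \<le> 1" "x \<in> {c..<d}" "{c..<d} \<subseteq> U"
      using R by blast
    moreover have "openin sorgenfrey {c..<d}"
      unfolding sorgenfrey_def by (rule topology_generated_by_Basis) (use calculation in blast)
    ultimately show "\<exists>T. openin sorgenfrey T \<and> x \<in> T \<and> T \<subseteq> U"
      by blast
  qed
qed

lemma topspace_sorgenfrey: "topspace sorgenfrey = {0..<1}"
proof
  show "topspace sorgenfrey \<subseteq> {0..<1}"
    by (auto simp: sorgenfrey_def)
  have "openin sorgenfrey {0..<1}"
    by (force simp: openin_sorgenfrey)
  then show "{0..<1} \<subseteq> topspace sorgenfrey"
    by (rule openin_subset)
qed

lemma Hausdorff_space_sorgenfrey: "Hausdorff_space sorgenfrey"
proof -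
  have sep: "\<exists>U V. openin sorgenfrey U \<and> openin sorgenfrey V \<and> x \<in> U \<and> y \<in> V \<and> disjnt U V"
    if "x < y" "0 \<le> x" "y < 1" for x y
  proof (intro exI conjI)
    show "openin sorgenfrey {x..<y}" "openin sorgenfrey {y..<1}"
      unfolding sorgenfrey_def
      by (rule topology_generated_by_Basis; use that in force)+
  qed (use that in \<open>auto simp: disjnt_iff\<close>)
  show ?thesis
    unfolding Hausdorff_space_def topspace_sorgenfrey
  proof (intro allI impI)
    fix x y :: real
    assume "x \<in> {0..<1} \<and> y \<in> {0..<1} \<and> x \<noteq> y"
    then consider "x < y" "0 \<le> x" "y < 1" | "y < x" "0 \<le> y" "x < 1"
      by fastforce
    then show "\<exists>U V. openin sorgenfrey U \<and> openin sorgenfrey V \<and> x \<in> U \<and> y \<in> V \<and> disjnt U V"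
    proof cases
      case 1
      then show ?thesis by (rule sep)
    next
      case 2
      then show ?thesis using sep[of y x] disjnt_sym by blast
    qed
  qed
qed

lemma topspace_vietoris: "topspace (vietoris X) = Exp X"
proof
  show "topspace (vietoris X) \<subseteq> Exp X"
    by (auto simp: vietoris_def)
  show "Exp X \<subseteq> topspace (vietoris X)"
  proof
    fix F assume F: "F \<in> Exp X"
    then have "F \<subseteq> topspace X" "F \<noteq> {}"
      by (auto simp: Exp_def dest: closedin_subset)
    then have "openin X (topspace X)" "topspace X \<noteq> {}" by auto
    then have "openin (vietoris X) {F \<in> Exp X. F \<subseteq> topspace X}"
      unfolding vietoris_def by (intro topology_generated_by_Basis) blast
    then show "F \<in> topspace (vietoris X)"
      using F \<open>F \<subseteq> topspace X\<close> openin_subset by blast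
  qed
qed

lemma closedin_nontrivial_convergent_sequence:
  assumes "Hausdorff_space X" and "nontrivial_convergent_sequence X S"
  shows "closedin X S"
proof -
  obtain x where S: "S \<subseteq> topspace X" and x: "x \<in> S"
      and fin: "\<And>V. openin X V \<Longrightarrow> x \<in> V \<Longrightarrow> finite (S - V)"
    using assms(2) by (auto simp: nontrivial_convergent_sequence_def)
  have "compactin X S"
    unfolding compactin_def
  proof (intro conjI allI impI S)
    fix \<U> assume \<U>: "Ball \<U> (openin X) \<and> S \<subseteq> \<Union> \<U>"
    then obtain V where V: "V \<in> \<U>" "x \<in> V" using x by blast
    with fin \<U> have "finite (S - V)" by blast
    moreover have "S - V \<subseteq> \<Union> \<U>" using \<U> by blast
    ultimately obtain \<F> where "finite \<F>" "\<F> \<subseteq> \<U>" "S - V \<subseteq> \<Union> \<F>"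
      by (rule finite_subset_Union)
    then show "\<exists>\<F>. finite \<F> \<and> \<F> \<subseteq> \<U> \<and> S \<subseteq> \<Union> \<F>"
      using V by (intro exI[of _ "insert V \<F>"]) auto
  qed
  with assms(1) show ?thesis
    by (rule compactin_imp_closedin)
qed

lemma topspace_conv_seq_space:
  assumes "Hausdorff_space X"
  shows "topspace (conv_seq_space X) = {S. nontrivial_convergent_sequence X S}"
proof -
  have "{S. nontrivial_convergent_sequence X S} \<subseteq> Exp X"
    using closedin_nontrivial_convergent_sequence[OF assms]
    by (auto simp: Exp_def nontrivial_convergent_sequence_def)
  then show ?thesis
    by (auto simp: conv_seq_space_def topspace_vietoris)
qed

end

theory Submission
  imports Defs
begin

text \<open>
  A homeomorphism of a space \<open>X\<close> acts on \<open>S\<^sub>c(X)\<close> by taking images, so it suffices to move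
  any nontrivial convergent sequence of the Sorgenfrey line to any other by a homeomorphism of
  the line. A rotation of \<open>[0,1[\<close> modulo 1 moves the limit to 0. A sequence with limit 0 is, apart
  from its limit, the range of a strictly decreasing sequence, and the increasing piecewise affine
  bijection matching two such sequences is a homeomorphism because it preserves the order.
\<close>

section \<open>Induced maps on hyperspaces\<close>

text \<open>It suffices to pull back subbasic sets, and the preimage of \<open>V\<close> under
  \<open>f\<close> yields a subbasic set of the same kind. Being a homeomorphism matters twice:
  images of closed sets stay closed, and surjectivity keeps preimages non-empty, as the subbase
  demands.\<close>

lemma continuous_map_vietoris_image:
  assumes "homeomorphic_map X Y f"
  shows "continuous_map (vietoris X) (vietoris Y) ((`) f)"
proof -
  have cont: "continuous_map X Y f" and surj: "f ` topspace X = topspace Y"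
    using assms by (auto simp: homeomorphic_eq_everything_map)
  have Exp: "f ` F \<in> Exp Y" if "F \<in> Exp X" for F
    using that assms closedin_subset
    by (auto simp: Exp_def homeomorphic_map_closedness_eq)
  define pre where "pre V = {x \<in> topspace X. f x \<in> V}" for V
  have pre: "openin X (pre V)" "pre V \<noteq> {}" if "openin Y V" "V \<noteq> {}" for V
  proof -
    show "openin X (pre V)"
      unfolding pre_def using cont that(1) by (rule openin_continuous_map_preimage)
    have "V \<subseteq> f ` topspace X" using surj openin_subset[OF that(1)] by simp
    then show "pre V \<noteq> {}"
      using that(2) unfolding pre_def by blast
  qed
  have sub: "F \<subseteq> topspace X" if "F \<in> Exp X" for F
    using that closedin_subset by (auto simp: Exp_def)
  have "openin (vietoris X) ((`) f -` {F \<in> Exp Y. F \<subseteq> V} \<inter> topspace (vietoris X))"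
    if "openin Y V" "V \<noteq> {}" for V
  proof -
    have "(`) f -` {F \<in> Exp Y. F \<subseteq> V} \<inter> topspace (vietoris X) = {F \<in> Exp X. F \<subseteq> pre V}"
      using Exp sub unfolding topspace_vietoris pre_def by blast
    also have "openin (vietoris X) \<dots>"
      unfolding vietoris_def using pre[OF that] by (intro topology_generated_by_Basis) blast
    finally show ?thesis .
  qed
  moreover have "openin (vietoris X) ((`) f -` {F \<in> Exp Y. F \<inter> V \<noteq> {}} \<inter> topspace (vietoris X))"
    if "openin Y V" "V \<noteq> {}" for V
  proof -
    have "(`) f -` {F \<in> Exp Y. F \<inter> V \<noteq> {}} \<inter> topspace (vietoris X) = {F \<in> Exp X. F \<inter> pre V \<noteq> {}}"
      using Exp sub unfolding topspace_vietoris pre_def by blast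
    also have "openin (vietoris X) \<dots>"
      unfolding vietoris_def using pre[OF that] by (intro topology_generated_by_Basis) blast
    finally show ?thesis .
  qed
  moreover have "(`) f ` topspace (vietoris X) \<subseteq> topspace (vietoris Y)"
    using Exp by (auto simp: topspace_vietoris)
  ultimately show ?thesis
    unfolding vietoris_def[of Y] continuous_on_generated_topo_iff topology_generated_by_topspace
    by blast
qed

lemma nontrivial_convergent_sequence_image:
  assumes "homeomorphic_map X Y f" and "nontrivial_convergent_sequence X S"
  shows "nontrivial_convergent_sequence Y (f ` S)"
proof -
  have cont: "continuous_map X Y f" and surj: "f ` topspace X = topspace Y"
    and inj: "inj_on f (topspace X)"
    using assms by (auto simp: homeomorphic_eq_everything_map)
  obtain x where S: "S \<subseteq> topspace X" "countable S" "infinite S" and x: "x \<in> S"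
    and fin: "\<And>V. openin X V \<Longrightarrow> x \<in> V \<Longrightarrow> finite (S - V)"
    using assms(2) by (auto simp: nontrivial_convergent_sequence_def)
  have "finite (f ` S - V)" if V: "openin Y V" "f x \<in> V" for V
  proof -
    have "finite (S - {x \<in> topspace X. f x \<in> V})"
      using fin openin_continuous_map_preimage[OF cont V(1)] V(2) x S(1) by blast
    then have "finite (f ` (S - {x \<in> topspace X. f x \<in> V}))" by simp
    moreover have "f ` S - V \<subseteq> f ` (S - {x \<in> topspace X. f x \<in> V})" by blast
    ultimately show ?thesis by (rule rev_finite_subset)
  qed
  moreover have "infinite (f ` S)"
    using S inj by (meson finite_imageD inj_on_subset)
  ultimately show ?thesis
    using S x surj by (auto simp: nontrivial_convergent_sequence_def)
qed

lemma continuous_map_conv_seq_space_image: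
  assumes "homeomorphic_map X Y f"
  shows "continuous_map (conv_seq_space X) (conv_seq_space Y) ((`) f)"
  using continuous_map_vietoris_image[OF assms] nontrivial_convergent_sequence_image[OF assms]
  unfolding conv_seq_space_def
  by (auto simp: continuous_map_in_subtopology continuous_map_from_subtopology)

lemma homeomorphic_map_conv_seq_space_image:
  assumes "homeomorphic_map X Y f"
  shows "homeomorphic_map (conv_seq_space X) (conv_seq_space Y) ((`) f)"
proof -
  obtain g where fg: "homeomorphic_maps X Y f g"
    using assms by (auto simp: homeomorphic_map_maps)
  have g: "homeomorphic_map Y X g"
    using fg homeomorphic_maps_map by blast
  have gf: "\<And>x. x \<in> topspace X \<Longrightarrow> g (f x) = x" "\<And>y. y \<in> topspace Y \<Longrightarrow> f (g y) = y"
    using fg by (auto simp: homeomorphic_maps_def)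
  have "continuous_map (conv_seq_space X) (conv_seq_space Y) ((`) f)"
    by (rule continuous_map_conv_seq_space_image) (rule assms)
  moreover have "continuous_map (conv_seq_space Y) (conv_seq_space X) ((`) g)"
    by (rule continuous_map_conv_seq_space_image) (rule g)
  moreover have "g ` f ` F = F" if "F \<in> topspace (conv_seq_space X)" for F
    \<comment> \<open>A convergent sequence lies inside the underlying space, which is where
      \<open>g\<close> inverts \<open>f\<close>.\<close>
    using that gf(1) by (force simp: image_image conv_seq_space_def nontrivial_convergent_sequence_def)
  moreover have "f ` g ` F = F" if "F \<in> topspace (conv_seq_space Y)" for F
    using that gf(2) by (force simp: image_image conv_seq_space_def nontrivial_convergent_sequence_def)
  ultimately have "homeomorphic_maps (conv_seq_space X) (conv_seq_space Y) ((`) f) ((`) g)"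
    by (simp add: homeomorphic_maps_def)
  then show ?thesis by (rule homeomorphic_maps_imp_map)
qed

section \<open>Homeomorphisms of the Sorgenfrey line\<close>

lemma continuous_map_sorgenfreyI:
  assumes "\<And>x. 0 \<le> x \<Longrightarrow> x < 1 \<Longrightarrow> 0 \<le> f x \<and> f x < 1"
    and "\<And>x e. 0 \<le> x \<Longrightarrow> x < 1 \<Longrightarrow> 0 < e \<Longrightarrow>
      \<exists>d>0. \<forall>t. x \<le> t \<and> t < x + d \<and> t < 1 \<longrightarrow> f x \<le> f t \<and> f t < f x + e"
  shows "continuous_map sorgenfrey sorgenfrey f"
  unfolding continuous_map_def
proof (intro conjI allI impI)
  show "f \<in> topspace sorgenfrey \<rightarrow> topspace sorgenfrey"
    using assms(1) by (auto simp: topspace_sorgenfrey)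
  fix U assume U: "openin sorgenfrey U"
  show "openin sorgenfrey {x \<in> topspace sorgenfrey. f x \<in> U}"
    unfolding openin_sorgenfrey topspace_sorgenfrey
  proof
    fix x assume "x \<in> {x \<in> {0..<1}. f x \<in> U}"
    then have x: "0 \<le> x" "x < 1" "f x \<in> U" by auto
    obtain u v where uv: "f x \<in> {u..<v}" "{u..<v} \<subseteq> U"
      using U x(3) unfolding openin_sorgenfrey by blast
    obtain d where d: "d > 0" "\<forall>t. x \<le> t \<and> t < x + d \<and> t < 1 \<longrightarrow> f x \<le> f t \<and> f t < f x + (v - f x)"
      using assms(2)[OF x(1,2), of "v - f x"] uv by auto
    have "{x..<min 1 (x + d)} \<subseteq> {x \<in> {0..<1}. f x \<in> U}"
    proof
      fix t assume "t \<in> {x..<min 1 (x + d)}"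
      then have t: "x \<le> t" "t < x + d" "t < 1" by auto
      have "f t \<in> {u..<v}" using d(2) t uv(1) by force
      then show "t \<in> {x \<in> {0..<1}. f x \<in> U}" using t x uv(2) by auto
    qed
    then show "\<exists>c d. 0 \<le> c \<and> c < d \<and> d \<le> 1 \<and> x \<in> {c..<d} \<and> {c..<d} \<subseteq> {x \<in> {0..<1}. f x \<in> U}"
      using x d(1) by (intro exI[of _ x] exI[of _ "min 1 (x + d)"]) auto
  qed
qed

text \<open>The cut at \<open>x\<close> does no harm, since [0, x[ and [x, 1[ are both open and the
  map is a translation on each. The rotation serves to carry the limit \<open>x\<close> to
  0.\<close>

lemma homeomorphic_map_sorgenfrey_rotation:
  assumes "0 \<le> x" "x < 1"
  shows "homeomorphic_map sorgenfrey sorgenfrey (\<lambda>t. if t < x then t - x + 1 else t - x)"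
proof -
  let ?f = "\<lambda>t::real. if t < x then t - x + 1 else t - x"
  let ?g = "\<lambda>t::real. if t < 1 - x then t + x else t + x - 1"
  have "continuous_map sorgenfrey sorgenfrey ?f"
  proof (rule continuous_map_sorgenfreyI)
    fix s e :: real assume "0 \<le> s" "s < 1" "0 < e"
    then show "\<exists>d>0. \<forall>t. s \<le> t \<and> t < s + d \<and> t < 1 \<longrightarrow> ?f s \<le> ?f t \<and> ?f t < ?f s + e"
      \<comment> \<open>To the left of the cut, \<open>d\<close> must also stop short of
        \<open>x\<close>.\<close>
      by (intro exI[of _ "if s < x then min e (x - s) else e"]) auto
  qed (use assms in auto)
  moreover have "continuous_map sorgenfrey sorgenfrey ?g"
  proof (rule continuous_map_sorgenfreyI)
    fix s e :: real assume "0 \<le> s" "s < 1" "0 < e"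
    then show "\<exists>d>0. \<forall>t. s \<le> t \<and> t < s + d \<and> t < 1 \<longrightarrow> ?g s \<le> ?g t \<and> ?g t < ?g s + e"
      by (intro exI[of _ "if s < 1 - x then min e (1 - x - s) else e"]) auto
  qed (use assms in auto)
  ultimately have "homeomorphic_maps sorgenfrey sorgenfrey ?f ?g"
    using assms by (auto simp: homeomorphic_maps_def topspace_sorgenfrey)
  then show ?thesis by (rule homeomorphic_maps_imp_map)
qed

text \<open>A strictly increasing surjection cannot jump: a preimage of \<open>f x + e\<close>
  bounds the required right neighbourhood of \<open>x\<close>.\<close>

lemma continuous_map_sorgenfrey_order_iso:
  assumes f: "\<And>x. 0 \<le> x \<Longrightarrow> x < 1 \<Longrightarrow> 0 \<le> f x \<and> f x < 1"
    and g: "\<And>x. 0 \<le> x \<Longrightarrow> x < 1 \<Longrightarrow> 0 \<le> g x \<and> g x < 1"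
    and fg: "\<And>x. 0 \<le> x \<Longrightarrow> x < 1 \<Longrightarrow> f (g x) = x"
    and mono: "\<And>x y. 0 \<le> x \<Longrightarrow> x < y \<Longrightarrow> y < 1 \<Longrightarrow> f x < f y"
  shows "continuous_map sorgenfrey sorgenfrey f"
proof (rule continuous_map_sorgenfreyI)
  fix x e :: real assume x: "0 \<le> x" "x < 1" "0 < e"
  have le: "f x \<le> f t" if "x \<le> t" "t < 1" for t
    using mono[of x t] x that by (cases "x = t") auto
  show "\<exists>d>0. \<forall>t. x \<le> t \<and> t < x + d \<and> t < 1 \<longrightarrow> f x \<le> f t \<and> f t < f x + e"
  proof (cases "f x + e < 1")
    case True
    let ?y = "g (f x + e)"
    have y: "0 \<le> ?y" "?y < 1" "f ?y = f x + e"
      using True f[OF x(1,2)] x(3) g fg by auto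
    have "x < ?y"
      using mono[of ?y x] y x by (cases x ?y rule: linorder_cases) simp_all
    then show ?thesis
      using le mono y x by (intro exI[of _ "?y - x"]) (smt (verit))
  next
    \<comment> \<open>Here \<open>f t < 1\<close> already gives the upper bound, so any
      \<open>d\<close> works.\<close>
    case False
    then show ?thesis
      using le f x by (intro exI[of _ 1]) (smt (verit))
  qed
qed (use f in auto)

section \<open>Matching decreasing sequences\<close>

text \<open>Starting the sequence at 1 lets the intervals \<open>[a (n+1), a n[\<close> partition \<open>]0,1[\<close>.\<close>

definition ladder :: "(nat \<Rightarrow> real) \<Rightarrow> bool" where
  "ladder a \<longleftrightarrow> a 0 = 1 \<and> (\<forall>n. 0 < a n \<and> a (Suc n) < a n) \<and> (\<forall>e>0. \<exists>n. a n < e)"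

text \<open>The piecewise affine map between corresponding rungs. The point 0 lies on no rung and is
  treated separately; for \<open>t\<close> in ]0, 1[ the least index picks the rung containing
  \<open>t\<close>.\<close>

definition ladder_map :: "(nat \<Rightarrow> real) \<Rightarrow> (nat \<Rightarrow> real) \<Rightarrow> real \<Rightarrow> real" where
  "ladder_map a b t =
     (if t \<le> 0 then 0
      else let n = (LEAST n. a (Suc n) \<le> t)
           in b (Suc n) + (t - a (Suc n)) / (a n - a (Suc n)) * (b n - b (Suc n)))"

lemma ladder_antimono:
  assumes "ladder a" "m \<le> n"
  shows "a n \<le> a m"
  using assms lift_Suc_antimono_le[of a m n] by (auto simp: ladder_def less_imp_le)

lemma ladder_rung:
  assumes "ladder a" "0 < t" "t < 1"
  obtains n where "a (Suc n) \<le> t" "t < a n"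
proof -
  let ?n = "LEAST n. a (Suc n) \<le> t"
  obtain m where "a m < t" using assms by (auto simp: ladder_def)
  then have "a (Suc m) \<le> t" using assms(1) by (force simp: ladder_def dest: spec[of _ m])
  then have le: "a (Suc ?n) \<le> t" by (rule LeastI)
  have "t < a ?n"
  proof (cases ?n)
    case 0
    then show ?thesis using assms by (simp add: ladder_def)
  next
    case (Suc k)
    then have "\<not> a (Suc k) \<le> t" using not_less_Least[of k "\<lambda>n. a (Suc n) \<le> t"] by simp
    then show ?thesis using Suc by simp
  qed
  with le that show ?thesis by blast
qed

lemma ladder_map_eq:
  assumes "ladder a" "a (Suc n) \<le> t" "t < a n"
  shows "ladder_map a b t = b (Suc n) + (t - a (Suc n)) / (a n - a (Suc n)) * (b n - b (Suc n))"
proof -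
  have "0 < a (Suc n)" using assms(1) by (simp add: ladder_def)
  moreover have "(LEAST n. a (Suc n) \<le> t) = n"
  proof (rule Least_equality)
    fix m assume m: "a (Suc m) \<le> t"
    show "n \<le> m"
    proof (rule ccontr)
      assume "\<not> n \<le> m"
      then have "a n \<le> a (Suc m)" by (intro ladder_antimono[OF assms(1)]) simp
      with m assms(3) show False by simp
    qed
  qed (fact assms(2))
  ultimately show ?thesis using assms(2) by (simp add: ladder_map_def)
qed

lemma ladder_map_rung:
  assumes "ladder a" "ladder b" "a (Suc n) \<le> t" "t < a n"
  shows "b (Suc n) \<le> ladder_map a b t" "ladder_map a b t < b n"
proof -
  have b: "b (Suc n) < b n" using assms(2) by (simp add: ladder_def)
  \<comment> \<open>The relative position of \<open>t\<close> in its rung, which the affine map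
    preserves.\<close>
  define q where "q = (t - a (Suc n)) / (a n - a (Suc n))"
  have "0 \<le> q" "q < 1" using assms(3,4) by (auto simp: q_def)
  then have "0 \<le> q * (b n - b (Suc n))" "q * (b n - b (Suc n)) < b n - b (Suc n)"
    using b by auto
  then show "b (Suc n) \<le> ladder_map a b t" "ladder_map a b t < b n"
    unfolding ladder_map_eq[OF assms(1,3,4)] q_def[symmetric] by linarith+
qed

text \<open>The image stays on the rung with the same index, so both maps use one \<open>n\<close>
  and their affine formulas cancel.\<close>

lemma ladder_map_inverse:
  assumes "ladder a" "ladder b" "0 \<le> t" "t < 1"
  shows "ladder_map b a (ladder_map a b t) = t"
proof (cases "t = 0")
  case True
  then show ?thesis by (simp add: ladder_map_def)
next
  case False
  with assms obtain n where n: "a (Suc n) \<le> t" "t < a n"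
    using ladder_rung[of a t] by auto
  have b: "b (Suc n) < b n" using assms(2) by (simp add: ladder_def)
  show ?thesis
    unfolding ladder_map_eq[OF assms(2) ladder_map_rung[OF assms(1,2) n]]
    unfolding ladder_map_eq[OF assms(1) n]
    using n b by simp
qed

lemma ladder_map_range:
  assumes "ladder a" "ladder b" "0 \<le> t" "t < 1"
  shows "0 \<le> ladder_map a b t \<and> ladder_map a b t < 1"
proof (cases "t = 0")
  case False
  with assms obtain n where n: "a (Suc n) \<le> t" "t < a n"
    using ladder_rung[of a t] by auto
  have "0 < b (Suc n)" "b n \<le> 1"
    using assms(2) ladder_antimono[of b 0 n] by (auto simp: ladder_def)
  then show ?thesis using ladder_map_rung[OF assms(1,2) n] by simp
qed (simp add: ladder_map_def)

lemma ladder_map_strict_mono: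
  assumes "ladder a" "ladder b" "0 \<le> s" "s < t" "t < 1"
  shows "ladder_map a b s < ladder_map a b t"
proof -
  obtain m where m: "a (Suc m) \<le> t" "t < a m"
    using assms ladder_rung[of a t] by auto
  note t = ladder_map_rung[OF assms(1,2) m]
  show ?thesis
  proof (cases "s = 0")
    case True
    moreover have "0 < b (Suc m)" using assms(2) by (simp add: ladder_def)
    ultimately show ?thesis using t(1) by (simp add: ladder_map_def)
  next
    case False
    then obtain n where n: "a (Suc n) \<le> s" "s < a n"
      using assms ladder_rung[of a s] by auto
    show ?thesis
    \<comment> \<open>Indices grow towards 0. Either \<open>s\<close> sits on a strictly lower rung,
      and the image rungs are ordered likewise, or \<open>s < t\<close> forces a common rung and the
      affine formula decides.\<close>
    proof (cases "m < n")
      case True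
      then have "b n \<le> b (Suc m)" by (intro ladder_antimono[OF assms(2)]) simp
      then show ?thesis using t ladder_map_rung[OF assms(1,2) n] by linarith
    next
      case False
      have "n = m"
      proof (rule ccontr)
        assume "n \<noteq> m"
        then have "a m \<le> a (Suc n)" using False by (intro ladder_antimono[OF assms(1)]) simp
        then show False using m n assms(4) by linarith
      qed
      moreover have "b (Suc m) < b m" using assms(2) by (simp add: ladder_def)
      ultimately show ?thesis
        unfolding ladder_map_eq[OF assms(1) m] ladder_map_eq[OF assms(1) n]
        using m n assms(4) by (simp add: divide_strict_right_mono)
    qed
  qed
qed

lemma homeomorphic_map_ladder_map:
  assumes "ladder a" "ladder b"
  shows "homeomorphic_map sorgenfrey sorgenfrey (ladder_map a b)"
proof -
  \<comment> \<open>Kept general in \<open>a\<close> and \<open>b\<close>, since the inverse swaps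
    them.\<close>
  have "continuous_map sorgenfrey sorgenfrey (ladder_map a b)" if "ladder a" "ladder b" for a b
    using ladder_map_range ladder_map_inverse ladder_map_strict_mono that
    by (intro continuous_map_sorgenfrey_order_iso[where g = "ladder_map b a"])
  then have "homeomorphic_maps sorgenfrey sorgenfrey (ladder_map a b) (ladder_map b a)"
    using assms ladder_map_inverse by (auto simp: homeomorphic_maps_def topspace_sorgenfrey)
  then show ?thesis by (rule homeomorphic_maps_imp_map)
qed

text \<open>Left endpoints of rungs go to left endpoints. The index shift drops
  \<open>a 0 = 1\<close>, which lies outside the space.\<close>

lemma ladder_map_image:
  assumes "ladder a" "ladder b"
  shows "ladder_map a b ` insert 0 (range (\<lambda>n. a (Suc n))) = insert 0 (range (\<lambda>n. b (Suc n)))"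
proof -
  have "ladder_map a b (a (Suc n)) = b (Suc n)" for n
    using ladder_map_eq[OF assms(1), of n "a (Suc n)" b] assms(1) by (simp add: ladder_def)
  moreover have "ladder_map a b 0 = 0" by (simp add: ladder_map_def)
  ultimately show ?thesis by (simp add: image_image)
qed

text \<open>Greedy enumeration: below any positive bound \<open>S\<close> has a largest element, so
  repeatedly taking it, starting from 1, lists all positive points of \<open>S\<close> in decreasing
  order.\<close>

lemma ladder_exists:
  fixes S :: "real set"
  assumes S: "S \<subseteq> {0..<1}" "0 \<in> S" "infinite S" and fin: "\<And>e. e > 0 \<Longrightarrow> finite (S \<inter> {e..})"
  obtains a where "ladder a" "S = insert 0 (range (\<lambda>n. a (Suc n)))"
proof -
  have max: "\<exists>v. 0 < v \<and> v < u \<and> v \<in> S \<and> S \<inter> {v<..<u} = {}" if u: "0 < u" for u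
  proof -
    \<comment> \<open>Otherwise \<open>S\<close> would be finite; hence some positive
      \<open>s\<close> in \<open>S\<close> lies below \<open>u\<close>.\<close>
    have "\<not> S \<subseteq> insert 0 (S \<inter> {u..})"
      using fin[OF u] S(3) finite_subset by blast
    then obtain s where s: "s \<in> S" "s \<noteq> 0" "s < u"
      unfolding subset_iff insert_iff Int_iff atLeast_iff not_le[symmetric] by blast
    then have "0 < s" using S(1) by fastforce
    \<comment> \<open>Cutting off at \<open>s\<close> makes the set finite without changing the
      maximum of \<open>S\<close> below \<open>u\<close>.\<close>
    let ?A = "S \<inter> {s..<u}"
    have A: "finite ?A" "?A \<noteq> {}"
      using fin[OF \<open>0 < s\<close>] s by (auto intro: rev_finite_subset)
    have "Max ?A \<in> ?A" using A by (rule Max_in)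
    moreover have "x \<le> Max ?A" if "x \<in> S" "x < u" for x
    proof (cases "s \<le> x")
      case True
      then show ?thesis using A that by (intro Max_ge) auto
    next
      case False
      then show ?thesis using \<open>Max ?A \<in> ?A\<close> by auto
    qed
    ultimately show ?thesis
      using \<open>0 < s\<close> by (intro exI[of _ "Max ?A"]) force
  qed
  have "\<exists>a. \<forall>n::nat. (0 < a n \<and> (n = 0 \<longrightarrow> a n = 1)) \<and>
      (a (Suc n) < a n \<and> a (Suc n) \<in> S \<and> S \<inter> {a (Suc n)<..<a n} = {})"
    by (rule dependent_nat_choice) (use max in \<open>auto intro: exI[of _ 1]\<close>)
  then obtain a :: "nat \<Rightarrow> real" where a0: "a 0 = 1" and pos: "\<And>n. 0 < a n"
    and dec: "\<And>n. a (Suc n) < a n" and mem: "\<And>n. a (Suc n) \<in> S"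
    and gap: "\<And>n. S \<inter> {a (Suc n)<..<a n} = {}"
    by metis
  \<comment> \<open>A sequence staying above \<open>e\<close> would put infinitely many distinct
    points into the finite set \<open>S \<inter> {e..}\<close>.\<close>
  have "\<exists>n. a n < e" if "e > 0" for e
  proof (rule ccontr)
    assume "\<nexists>n. a n < e"
    then have "range (\<lambda>n. a (Suc n)) \<subseteq> S \<inter> {e..}" using mem by (auto simp: not_less)
    then have "finite (range (\<lambda>n. a (Suc n)))" using fin[OF that] by (rule finite_subset)
    moreover have "inj (\<lambda>n. a (Suc n))"
    proof -
      have "strict_mono (\<lambda>n. - a (Suc n))" using dec by (intro strict_monoI_Suc) simp
      then have "inj (\<lambda>n. - a (Suc n))" by (rule strict_mono_imp_inj_on)
      then show ?thesis by (simp add: inj_def)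
    qed
    ultimately show False using finite_imageD by blast
  qed
  then have lad: "ladder a" using a0 pos dec by (simp add: ladder_def)
  have "x \<in> range (\<lambda>n. a (Suc n))" if x: "x \<in> S" "x \<noteq> 0" for x
  proof -
    have "0 < x" "x < 1" using x S(1) by fastforce+
    then obtain n where n: "a (Suc n) \<le> x" "x < a n" by (rule ladder_rung[OF lad])
    \<comment> \<open>No point of \<open>S\<close> lies strictly inside a rung, so only the left
      endpoint remains.\<close>
    then have "x = a (Suc n)" using gap[of n] x(1) by force
    then show ?thesis by blast
  qed
  then have "S = insert 0 (range (\<lambda>n. a (Suc n)))" using mem S(2) by auto
  with lad that show ?thesis by blast
qed

text \<open>Normal form: once the limit is rotated to 0, convergence says that only finitely many
  points lie above each \<open>e > 0\<close>, and the greedy enumeration applies.\<close>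

lemma sorgenfrey_conv_seq_ladder:
  assumes "nontrivial_convergent_sequence sorgenfrey S"
  obtains r a where "homeomorphic_map sorgenfrey sorgenfrey r" "ladder a"
    "r ` S = insert 0 (range (\<lambda>n. a (Suc n)))"
proof -
  obtain x where S: "S \<subseteq> {0..<1}" "infinite S" and x: "x \<in> S"
    and fin: "\<And>V. openin sorgenfrey V \<Longrightarrow> x \<in> V \<Longrightarrow> finite (S - V)"
    using assms by (auto simp: nontrivial_convergent_sequence_def topspace_sorgenfrey)
  have x01: "0 \<le> x" "x < 1" using S x by auto
  define r where "r t = (if t < x then t - x + 1 else t - x)" for t
  have r: "homeomorphic_map sorgenfrey sorgenfrey r"
    unfolding r_def using x01 by (rule homeomorphic_map_sorgenfrey_rotation)
  have inj: "inj_on r S"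
    using r S(1) unfolding homeomorphic_eq_everything_map topspace_sorgenfrey
    by (meson inj_on_subset)
  have finr: "finite (r ` S \<inter> {e..})" if "e > 0" for e
  proof -
    have "openin sorgenfrey {x..<min 1 (x + e)}"
      unfolding sorgenfrey_def using x01 that by (intro topology_generated_by_Basis) force
    then have "finite (S - {x..<min 1 (x + e)})" using fin x01 that by simp
    \<comment> \<open>On the removed interval \<open>r t = t - x < e\<close>.\<close>
    moreover have "r ` S \<inter> {e..} \<subseteq> r ` (S - {x..<min 1 (x + e)})"
      by (force simp: r_def)
    ultimately show ?thesis using finite_surj by blast
  qed
  have "r ` S \<subseteq> {0..<1}" using S(1) x01 by (auto simp: r_def)
  moreover have "0 \<in> r ` S" using x by (auto simp: r_def image_iff intro!: bexI[of _ x])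
  moreover have "infinite (r ` S)" using S(2) inj finite_imageD by blast
  ultimately obtain a where "ladder a" "r ` S = insert 0 (range (\<lambda>n. a (Suc n)))"
    using ladder_exists finr by blast
  with r that show ?thesis by blast
qed

theorem proposition2p3:
  shows "homogeneous_space (conv_seq_space sorgenfrey)"
  unfolding homogeneous_space_def topspace_conv_seq_space[OF Hausdorff_space_sorgenfrey]
proof (intro ballI)
  fix S T
  assume "S \<in> {S. nontrivial_convergent_sequence sorgenfrey S}"
    and "T \<in> {S. nontrivial_convergent_sequence sorgenfrey S}"
  then have S: "nontrivial_convergent_sequence sorgenfrey S"
    and T: "nontrivial_convergent_sequence sorgenfrey T" by auto
  obtain p a where p: "homeomorphic_map sorgenfrey sorgenfrey p" and a: "ladder a"
    and pS: "p ` S = insert 0 (range (\<lambda>n. a (Suc n)))"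
    using S by (rule sorgenfrey_conv_seq_ladder)
  obtain q b where q: "homeomorphic_map sorgenfrey sorgenfrey q" and b: "ladder b"
    and qT: "q ` T = insert 0 (range (\<lambda>n. b (Suc n)))"
    using T by (rule sorgenfrey_conv_seq_ladder)
  obtain q' where qq': "homeomorphic_maps sorgenfrey sorgenfrey q q'"
    using q by (auto simp: homeomorphic_map_maps)
  \<comment> \<open>Normalise \<open>S\<close>, match its normal form with that of \<open>T\<close>,
    then undo the normalisation of \<open>T\<close>.\<close>
  let ?h = "q' \<circ> (ladder_map a b \<circ> p)"
  have "homeomorphic_map sorgenfrey sorgenfrey q'"
    using qq' homeomorphic_maps_map by blast
  with p homeomorphic_map_ladder_map[OF a b] have "homeomorphic_map sorgenfrey sorgenfrey ?h"
    by (intro homeomorphic_map_compose)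
  then have "homeomorphic_map (conv_seq_space sorgenfrey) (conv_seq_space sorgenfrey) ((`) ?h)"
    by (rule homeomorphic_map_conv_seq_space_image)
  moreover have "?h ` S = T"
  proof -
    have "T \<subseteq> topspace sorgenfrey"
      using T by (simp add: nontrivial_convergent_sequence_def)
    then have inv: "q' (q t) = t" if "t \<in> T" for t
      using qq' that by (auto simp: homeomorphic_maps_def)
    have "?h ` S = q' ` q ` T"
      unfolding image_comp[symmetric] pS qT ladder_map_image[OF a b] ..
    also have "\<dots> = T"
      using inv by (simp add: image_image)
    finally show ?thesis .
  qed
  ultimately show "\<exists>h. homeomorphic_map (conv_seq_space sorgenfrey) (conv_seq_space sorgenfrey) h
      \<and> h S = T" by blast
qed

end
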